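(* Let $\lambda$ be a nonzero real number. For every $n\in\mathbb{N}$ (that is, $n\ge 1$), $$H_{n,\lambda}\,x^{n}=\frac{1}{n!}\sum_{k=1}^{n}S_{1,\lambda}(n,k)\,HF_{k,\lambda}(x).$$ In particular, for $x=1$, $$H_{n,\lambda}=\frac{1}{n!}\sum_{k=1}^{n}S_{1,\lambda}(n,k)\,HF_{k,\lambda}.$$
   Context: Fix a nonzero real $\lambda$. All generating functions are formal power series, with $(1+u)^{a}=\sum_{j\ge0}\binom{a}{j}u^{j}$. Notation: $(x)_{0,\lambda}=1$ and $(x)_{n,\lambda}=x(x-\lambda)\cdots(x-(n-1)\lambda)$ for $n\ge1$; $(x)_0=1$ and $(x)_n=x(x-1)\cdots(x-n+1)$ for $n\ge 1$. Degenerate logarithm: $\log_{\lambda}(1+t)=\frac{1}{\lambda}\big((1+t)^{\lambda}-1\big)$. Degenerate exponential: $e_{\lambda}(t)=(1+\lambda t)^{1/\lambda}=\sum_{n\ge0}(1)_{n,\lambda}\frac{t^{n}}{n!}$. Degenerate Stirling numbers of the first kind $S_{1,\lambda}(n,k)$: defined by $(x)_{n}=\sum_{k=0}^{n}S_{1,\lambda}(n,k)(x)_{k,\lambda}$, $n\ge0$. Degenerate harmonic numbers $H_{n,\lambda}$: defined by $-\frac{\log_{\lambda}(1-t)}{1-t}=\sum_{n=1}^{\infty}H_{n,\lambda}t^{n}$. Degenerate harmonic-Fubini polynomials $HF_{n,\lambda}(x)$: defined by $$-\frac{\log_{\lambda}\big(1-x(e_{\lambda}(t)-1)\big)}{1-x(e_{\lambda}(t)-1)}=\sum_{n=1}^{\infty}HF_{n,\lambda}(x)\frac{t^{n}}{n!}.$$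 Degenerate harmonic-Fubini numbers: $HF_{n,\lambda}=HF_{n,\lambda}(1)$. *)

theory Defs
  imports Complex_Main "HOL-Computational_Algebra.Formal_Power_Series"
begin

definition falling_fact :: "real \<Rightarrow> nat \<Rightarrow> real" where
  "falling_fact x n = (\<Prod>i<n. x - real i)"

definition deg_falling_fact :: "real \<Rightarrow> real \<Rightarrow> nat \<Rightarrow> real" where
  "deg_falling_fact lam x n = (\<Prod>i<n. x - real i * lam)"

text \<open>
  Here \<open>fps_binomial a\<close> is the library's series of \<open>(1 + u)\<close> to the power \<open>a\<close>.
  The series \<open>deg_log lam\<close> is the expansion of the degenerate logarithm at \<open>1 + u\<close>
  in powers of \<open>u\<close>, so the degenerate logarithm of \<open>1 + f\<close> is \<open>deg_log lam oo f\<close>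
  for every \<open>f\<close> with zero constant term.
\<close>

definition deg_log :: "real \<Rightarrow> real fps" where
  "deg_log lam = fps_const (1 / lam) * (fps_binomial lam - 1)"

definition deg_exp :: "real \<Rightarrow> real fps" where
  "deg_exp lam = fps_binomial (1 / lam) oo (fps_const lam * fps_X)"

lemma deg_exp_nth:
  assumes "lam \<noteq> 0"
  shows "fps_nth (deg_exp lam) n = deg_falling_fact lam 1 n / fact n"
proof -
  have "lam ^ n * (\<Prod>i<n. 1 / lam - real i) = (\<Prod>i<n. lam * (1 / lam - real i))"
    by (simp add: prod.distrib)
  also have "\<dots> = (\<Prod>i<n. 1 - real i * lam)"
    using assms by (intro prod.cong) (auto simp: field_simps)
  finally show ?thesis
    by (simp add: deg_exp_def fps_compose_linear deg_falling_fact_def gbinomial_prod_rev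
        lessThan_atLeast0)
qed

text \<open>
  The degenerate Stirling numbers of the first kind are the connection coefficients
  between the two falling factorial bases. The condition \<open>c k = 0\<close> for \<open>k > n\<close> only fixes
  the values outside the range \<open>0 \<le> k \<le> n\<close> in which the expansion determines them.
\<close>

definition is_deg_stirling1 :: "real \<Rightarrow> nat \<Rightarrow> (nat \<Rightarrow> real) \<Rightarrow> bool" where
  "is_deg_stirling1 lam n c \<longleftrightarrow>
     (\<forall>x. falling_fact x n = (\<Sum>k=0..n. c k * deg_falling_fact lam x k)) \<and> (\<forall>k>n. c k = 0)"

definition deg_stirling1 :: "real \<Rightarrow> nat \<Rightarrow> nat \<Rightarrow> real" where
  "deg_stirling1 lam n = (THE c. is_deg_stirling1 lam n c)"

lemma ex_is_deg_stirling1: "\<exists>c. is_deg_stirling1 lam n c"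
proof (induction n)
  case 0
  show ?case
    by (rule exI[of _ "\<lambda>k. if k = 0 then 1 else 0"])
      (simp add: is_deg_stirling1_def falling_fact_def deg_falling_fact_def)
next
  case (Suc n)
  then obtain c where c: "\<And>x. falling_fact x n = (\<Sum>k=0..n. c k * deg_falling_fact lam x k)"
    and c0: "\<And>k. k > n \<Longrightarrow> c k = 0"
    by (auto simp: is_deg_stirling1_def)
  define d where "d k = (if k = 0 then 0 else c (k - 1)) + (real k * lam - real n) * c k" for k
  have "falling_fact x (Suc n) = (\<Sum>k=0..Suc n. d k * deg_falling_fact lam x k)" for x
  proof -
    let ?D = "deg_falling_fact lam x"
    have D: "?D (Suc k) = ?D k * (x - real k * lam)" for k
      by (simp add: deg_falling_fact_def)
    have "falling_fact x (Suc n) = (\<Sum>k=0..n. c k * ?D k * (x - real n))"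
      using c[of x] by (simp add: falling_fact_def sum_distrib_right)
    also have "\<dots> = (\<Sum>k=0..n. c k * ?D (Suc k) + (real k * lam - real n) * c k * ?D k)"
      by (intro sum.cong) (auto simp: D algebra_simps)
    also have "\<dots> = (\<Sum>k=0..n. c k * ?D (Suc k)) + (\<Sum>k=0..n. (real k * lam - real n) * c k * ?D k)"
      by (simp add: sum.distrib)
    also have "(\<Sum>k=0..n. c k * ?D (Suc k)) =
        (\<Sum>k=0..Suc n. (if k = 0 then 0 else c (k - 1)) * ?D k)"
      by (subst sum.atLeast0_atMost_Suc_shift) simp
    also have "(\<Sum>k=0..n. (real k * lam - real n) * c k * ?D k) =
        (\<Sum>k=0..Suc n. (real k * lam - real n) * c k * ?D k)"
      by (simp add: c0)
    finally show ?thesis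
      by (simp only: d_def distrib_right sum.distrib)
  qed
  moreover have "d k = 0" if "k > Suc n" for k
    using that by (simp add: d_def c0)
  ultimately show ?case
    unfolding is_deg_stirling1_def by blast
qed

lemma is_deg_stirling1_unique:
  assumes "lam \<noteq> 0" "is_deg_stirling1 lam n c" "is_deg_stirling1 lam n d"
  shows "c = d"
proof
  fix m
  show "c m = d m"
  proof (induction m rule: less_induct)
    case (less m)
    show ?case
    proof (cases "m \<le> n")
      case False
      then show ?thesis using assms by (simp add: is_deg_stirling1_def)
    next
      case True
      let ?D = "deg_falling_fact lam (real m * lam)"
      have "(\<Sum>k=0..n. (c k - d k) * ?D k) = 0"
        using assms(2,3) by (simp add: is_deg_stirling1_def left_diff_distrib sum_subtractf)
      also have "(\<Sum>k=0..n. (c k - d k) * ?D k) = (\<Sum>k\<in>{m}. (c k - d k) * ?D k)"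
      proof (rule sum.mono_neutral_right)
        show "\<forall>k\<in>{0..n} - {m}. (c k - d k) * ?D k = 0"
        proof
          fix k assume "k \<in> {0..n} - {m}"
          then consider "k < m" | "m < k" by fastforce
          then show "(c k - d k) * ?D k = 0"
            by cases (auto simp: less deg_falling_fact_def)
        qed
      qed (use True in auto)
      finally have "(c m - d m) * ?D m = 0" by simp
      moreover have "?D m \<noteq> 0"
        using assms(1) by (simp add: deg_falling_fact_def)
      ultimately show ?thesis by simp
    qed
  qed
qed

lemma is_deg_stirling1_deg_stirling1:
  assumes "lam \<noteq> 0"
  shows "is_deg_stirling1 lam n (deg_stirling1 lam n)"
proof -
  obtain c where c: "is_deg_stirling1 lam n c"
    using ex_is_deg_stirling1 by blast
  show ?thesis
    unfolding deg_stirling1_def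
    by (rule theI[where a = c]) (use c is_deg_stirling1_unique[OF assms] in auto)
qed

lemma falling_fact_eq_sum_deg_stirling1:
  assumes "lam \<noteq> 0"
  shows "falling_fact x n = (\<Sum>k=0..n. deg_stirling1 lam n k * deg_falling_fact lam x k)"
  using is_deg_stirling1_deg_stirling1[OF assms] by (simp add: is_deg_stirling1_def)

definition deg_harmonic :: "real \<Rightarrow> nat \<Rightarrow> real" where
  "deg_harmonic lam n = fps_nth (- (deg_log lam oo (- fps_X)) / (1 - fps_X)) n"

text \<open>
  The degenerate harmonic-Fubini polynomials are represented by their values at real \<open>x\<close>;
  the series below is a power series in \<open>t\<close> for fixed \<open>x\<close>.
\<close>

definition deg_harmonic_fubini_fps :: "real \<Rightarrow> real \<Rightarrow> real fps" where
  "deg_harmonic_fubini_fps lam x =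
     - (deg_log lam oo (- (fps_const x * (deg_exp lam - 1))))
       / (1 - fps_const x * (deg_exp lam - 1))"

definition deg_harmonic_fubini :: "real \<Rightarrow> nat \<Rightarrow> real \<Rightarrow> real" where
  "deg_harmonic_fubini lam n x = fact n * fps_nth (deg_harmonic_fubini_fps lam x) n"

definition deg_harmonic_fubini_number :: "real \<Rightarrow> nat \<Rightarrow> real" where
  "deg_harmonic_fubini_number lam n = deg_harmonic_fubini lam n 1"

text \<open>Both generating functions have zero constant term, so their expansions start at \<open>n = 1\<close>.\<close>

lemma deg_harmonic_0: "deg_harmonic lam 0 = 0"
  by (simp add: deg_harmonic_def deg_log_def fps_divide_unit)

lemma deg_harmonic_fubini_0: "deg_harmonic_fubini lam 0 x = 0"
  by (simp add: deg_harmonic_fubini_def deg_harmonic_fubini_fps_def deg_log_def deg_exp_def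
      fps_divide_unit)

end

theory Submission
  imports Defs
begin

text \<open>
  Read as a change of variables, the identity says that the degenerate Stirling numbers of the
  first kind undo the substitution \<open>u = e(t) - 1\<close>, where \<open>e\<close> is the degenerate exponential.
  The harmonic-Fubini series is the series \<open>\<Sum>n. H n * x ^ n * u ^ n\<close> after this substitution,
  with \<open>H n\<close> the degenerate harmonic numbers (\<open>deg_harmonic_fubini_fps_eq_compose\<close>), so it
  suffices to recover the coefficients of an arbitrary series \<open>G(u)\<close> from those of
  \<open>G(e(t) - 1)\<close>.

  For this, the \<open>n\<close>-th row of Stirling numbers is regarded as a linear functional
  \<open>L\<close> on power series in \<open>t\<close>, with \<open>L (t ^ k / k!) = S(n, k)\<close>. Since \<open>e(t) ^ j\<close> is the exponential
  generating function of the degenerate falling factorials of \<open>j\<close>, the defining expansion of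
  the Stirling numbers says that \<open>L (e(t) ^ j)\<close> is the falling factorial of \<open>j\<close> of length
  \<open>n\<close>, which is \<open>n!\<close> times the coefficient of \<open>u ^ n\<close> in \<open>(1 + u) ^ j\<close>
  (\<open>stirling_functional_deg_exp_power\<close>). The powers of
  \<open>1 + u\<close> span all polynomials in \<open>u\<close>, so by linearity \<open>L\<close> maps \<open>G(e(t) - 1)\<close> to \<open>n!\<close> times the
  coefficient of \<open>u ^ n\<close> in \<open>G\<close>, for polynomials \<open>G\<close>. This extends to all power series because
  \<open>L\<close> only sees the coefficients up to degree \<open>n\<close> and \<open>e(t) - 1\<close> has zero constant term
  (\<open>stirling_functional_compose_deg_exp\<close>).
\<close>

definition stirling_functional :: "real \<Rightarrow> nat \<Rightarrow> real fps \<Rightarrow> real" where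
  "stirling_functional lam n f = (\<Sum>k=0..n. deg_stirling1 lam n k * (fact k * fps_nth f k))"

lemma stirling_functional_add:
  "stirling_functional lam n (f + g) = stirling_functional lam n f + stirling_functional lam n g"
  by (simp add: stirling_functional_def algebra_simps sum.distrib)

lemma stirling_functional_const_mult:
  "stirling_functional lam n (fps_const c * f) = c * stirling_functional lam n f"
  by (simp add: stirling_functional_def sum_distrib_left algebra_simps)

lemma stirling_functional_sum:
  "finite A \<Longrightarrow>
     stirling_functional lam n (\<Sum>i\<in>A. f i) = (\<Sum>i\<in>A. stirling_functional lam n (f i))"
  by (induction A rule: finite_induct)
    (simp_all add: stirling_functional_add, simp add: stirling_functional_def)

text \<open>
  The power \<open>e(t) ^ j = (1 + lam * t) ^ (j / lam)\<close> is again a binomial series; its coefficients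
  are generalised binomial coefficients of \<open>j / lam\<close>, and the factor \<open>lam ^ k\<close> from the rescaled
  variable clears the denominators in their numerator product.
\<close>

lemma deg_exp_power_nth:
  assumes "lam \<noteq> 0"
  shows "fps_nth (deg_exp lam ^ j) k = deg_falling_fact lam (real j) k / fact k"
proof -
  have "deg_exp lam ^ j = fps_binomial (real j / lam) oo (fps_const lam * fps_X)"
    unfolding deg_exp_def
    by (simp add: fps_compose_power fps_binomial_power)
  moreover have "lam ^ k * (\<Prod>i<k. real j / lam - real i) = deg_falling_fact lam (real j) k"
  proof -
    have "lam ^ k * (\<Prod>i<k. real j / lam - real i) = (\<Prod>i<k. lam * (real j / lam - real i))"
      by (simp add: prod.distrib)
    also have "\<dots> = deg_falling_fact lam (real j) k"
      unfolding deg_falling_fact_def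
      using assms by (intro prod.cong) (auto simp: field_simps)
    finally show ?thesis .
  qed
  ultimately show ?thesis
    by (simp add: fps_compose_linear gbinomial_prod_rev lessThan_atLeast0)
qed

text \<open>
  By \<open>deg_exp_power_nth\<close>, the functional turns \<open>e(t) ^ j\<close> into the expansion of a falling factorial
  in degenerate ones, evaluated at \<open>j\<close>. The right-hand side is written as a coefficient of
  \<open>(1 + u) ^ j\<close> so that both sides are linear in the power series to which they are applied.
\<close>

lemma stirling_functional_deg_exp_power:
  assumes "lam \<noteq> 0"
  shows "stirling_functional lam n (deg_exp lam ^ j) = fact n * fps_nth ((1 + fps_X) ^ j) n"
proof -
  have "stirling_functional lam n (deg_exp lam ^ j) = falling_fact (real j) n"
    unfolding falling_fact_eq_sum_deg_stirling1[OF assms] stirling_functional_def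
    using assms by (intro sum.cong) (auto simp: deg_exp_power_nth)
  also have "\<dots> = fact n * (real j gchoose n)"
    by (simp add: falling_fact_def gbinomial_prod_rev lessThan_atLeast0)
  also have "real j gchoose n = fps_nth ((1 + fps_X) ^ j) n"
    by (simp add: fps_binomial_of_nat [symmetric])
  finally show ?thesis .
qed

lemma fps_minus_one_power_expansion:
  fixes f :: "'a::comm_ring_1 fps"
  shows "(f - 1) ^ m = (\<Sum>j\<le>m. fps_const (of_nat (m choose j) * (-1) ^ (m - j)) * f ^ j)"
proof -
  have "(f - 1) ^ m = (f + (- 1)) ^ m"
    by simp
  also have "\<dots> = (\<Sum>j\<le>m. of_nat (m choose j) * f ^ j * (- 1) ^ (m - j))"
    by (rule binomial_ring)
  also have "\<dots> = (\<Sum>j\<le>m. fps_const (of_nat (m choose j) * (-1) ^ (m - j)) * f ^ j)"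
  proof (intro sum.cong refl)
    fix j
    have "(- 1 :: 'a fps) ^ (m - j) = fps_const ((- 1) ^ (m - j))"
      by (simp add: fps_const_power [symmetric] del: fps_const_power flip: fps_const_neg)
    then show "of_nat (m choose j) * f ^ j * (- 1) ^ (m - j) =
        fps_const (of_nat (m choose j) * (-1) ^ (m - j)) * f ^ j"
      by (simp add: fps_of_nat [symmetric] fps_const_mult [symmetric] mult_ac
          del: fps_const_mult)
  qed
  finally show ?thesis .
qed

text \<open>
  Both \<open>(e(t) - 1) ^ m\<close> and \<open>u ^ m = ((1 + u) - 1) ^ m\<close> have the same coefficients when expanded
  in powers of \<open>e(t)\<close> and of \<open>1 + u\<close>, so the previous correspondence carries one to the other.
\<close>

lemma stirling_functional_deg_exp_minus_one_power:
  assumes "lam \<noteq> 0"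
  shows "stirling_functional lam n ((deg_exp lam - 1) ^ m) = (if m = n then fact n else 0)"
proof -
  let ?c = "\<lambda>j. real (m choose j) * (-1) ^ (m - j)"
  have "stirling_functional lam n ((deg_exp lam - 1) ^ m) =
      (\<Sum>j\<le>m. ?c j * (fact n * fps_nth ((1 + fps_X) ^ j) n))"
    unfolding fps_minus_one_power_expansion
    by (simp only: stirling_functional_sum finite_atMost stirling_functional_const_mult
        stirling_functional_deg_exp_power[OF assms])
  also have "\<dots> = fact n * fps_nth (\<Sum>j\<le>m. fps_const (?c j) * (1 + fps_X) ^ j) n"
    by (simp add: fps_sum_nth sum_distrib_left mult_ac)
  also have "\<dots> = fact n * fps_nth (((1 + fps_X) - 1) ^ m) n"
    by (simp only: fps_minus_one_power_expansion)
  finally show ?thesis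
    by (simp add: fps_X_power_nth)
qed

text \<open>
  This is the inversion principle: the Stirling numbers recover the coefficients of a series
  from those obtained after substituting \<open>e(t) - 1\<close>. Powers of \<open>e(t) - 1\<close> beyond the \<open>n\<close>-th have
  no terms of degree up to \<open>n\<close>, so the composition behaves as a finite sum.
\<close>

theorem stirling_functional_compose_deg_exp:
  assumes "lam \<noteq> 0"
  shows "stirling_functional lam n (G oo (deg_exp lam - 1)) = fact n * fps_nth G n"
proof -
  let ?P = "deg_exp lam - 1"
  have "fps_nth (G oo ?P) k = (\<Sum>m=0..n. fps_nth G m * fps_nth (?P ^ m) k)" if "k \<le> n" for k
  proof -
    have "fps_nth ?P 0 = 0"
      by (simp add: deg_exp_def)
    then have "fps_nth (?P ^ m) k = 0" if "m > k" for m
      using startsby_zero_power_prefix that by blast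
    then show ?thesis
      unfolding fps_compose_nth using that by (intro sum.mono_neutral_left) auto
  qed
  then have "stirling_functional lam n (G oo ?P) =
      (\<Sum>k=0..n. \<Sum>m=0..n. fps_nth G m * (deg_stirling1 lam n k * (fact k * fps_nth (?P ^ m) k)))"
    unfolding stirling_functional_def
    by (intro sum.cong) (auto simp: sum_distrib_left mult_ac)
  also have "\<dots> = (\<Sum>m=0..n. fps_nth G m * stirling_functional lam n (?P ^ m))"
    unfolding stirling_functional_def by (subst sum.swap) (simp add: sum_distrib_left)
  also have "\<dots> = fact n * fps_nth G n"
    by (simp add: stirling_functional_deg_exp_minus_one_power[OF assms] if_distrib cong: if_cong)
  finally show ?thesis .
qed

text \<open>
  Scaling \<open>H n\<close> by \<open>x ^ n\<close> amounts to substituting \<open>x * u\<close> for \<open>u\<close> in the generating function of the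
  degenerate harmonic numbers, and composition with \<open>x * (e(t) - 1)\<close> respects the quotient that
  defines this function.
\<close>

lemma deg_harmonic_fubini_fps_eq_compose:
  "deg_harmonic_fubini_fps lam x =
     Abs_fps (\<lambda>n. deg_harmonic lam n * x ^ n) oo (deg_exp lam - 1)"
proof -
  let ?P = "deg_exp lam - 1"
  define F where "F = - (deg_log lam oo (- fps_X)) / (1 - fps_X)"
  have P0: "fps_nth ?P 0 = 0"
    by (simp add: deg_exp_def)
  have xP0: "fps_nth (fps_const x * ?P) 0 = 0"
    using P0 by simp
  \<comment> \<open>The quotients are compared after clearing denominators, where composition is multiplicative.\<close>
  have F_mult: "F * (1 - fps_X) = - (deg_log lam oo (- fps_X))"
    unfolding F_def by (simp add: fps_divide_unit mult.assoc inverse_mult_eq_1)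
  have "Abs_fps (\<lambda>n. deg_harmonic lam n * x ^ n) = F oo (fps_const x * fps_X)"
    unfolding fps_compose_linear by (simp add: deg_harmonic_def F_def mult.commute)
  then have "Abs_fps (\<lambda>n. deg_harmonic lam n * x ^ n) oo ?P = F oo (fps_const x * ?P)"
    using P0 by (simp add: fps_compose_assoc [symmetric] fps_compose_mult_distrib)
  moreover have "(F oo (fps_const x * ?P)) * (1 - fps_const x * ?P) =
      - (deg_log lam oo (- (fps_const x * ?P)))"
  proof -
    have "(F oo (fps_const x * ?P)) * (1 - fps_const x * ?P) =
        (F * (1 - fps_X)) oo (fps_const x * ?P)"
      using xP0 by (simp add: fps_compose_mult_distrib fps_compose_sub_distrib del: fps_mult_nth_0)
    also have "\<dots> = - (deg_log lam oo (- (fps_const x * ?P)))"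
      unfolding F_mult using xP0
      by (simp add: fps_compose_uminus fps_compose_assoc [symmetric] del: fps_mult_nth_0)
    finally show ?thesis .
  qed
  moreover have "1 - fps_const x * ?P \<noteq> 0"
  proof
    assume "1 - fps_const x * ?P = 0"
    then have "fps_nth (1 - fps_const x * ?P) 0 = 0"
      by simp
    with P0 show False
      by simp
  qed
  ultimately show ?thesis
    unfolding deg_harmonic_fubini_fps_def by (metis nonzero_mult_div_cancel_right)
qed

theorem theorem2:
  fixes lam :: real and n :: nat
  assumes "lam \<noteq> 0" and "n \<ge> 1"
  shows "(\<forall>x::real. deg_harmonic lam n * x ^ n =
            1 / fact n * (\<Sum>k=1..n. deg_stirling1 lam n k * deg_harmonic_fubini lam k x)) \<and>
         deg_harmonic lam n =
            1 / fact n * (\<Sum>k=1..n. deg_stirling1 lam n k * deg_harmonic_fubini_number lam k)"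
proof -
  have *: "deg_harmonic lam n * x ^ n =
      1 / fact n * (\<Sum>k=1..n. deg_stirling1 lam n k * deg_harmonic_fubini lam k x)" for x
  proof -
    have "fact n * (deg_harmonic lam n * x ^ n) =
        stirling_functional lam n (deg_harmonic_fubini_fps lam x)"
      using stirling_functional_compose_deg_exp[OF assms(1)]
      by (simp add: deg_harmonic_fubini_fps_eq_compose)
    also have "\<dots> = (\<Sum>k=0..n. deg_stirling1 lam n k * deg_harmonic_fubini lam k x)"
      by (simp add: stirling_functional_def deg_harmonic_fubini_def)
    also have "\<dots> = (\<Sum>k=1..n. deg_stirling1 lam n k * deg_harmonic_fubini lam k x)"
      by (simp add: sum.atLeast_Suc_atMost deg_harmonic_fubini_0)
    finally show ?thesis
      by (simp add: field_simps)
  qed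
  then show ?thesis
    using *[of 1] by (simp add: deg_harmonic_fubini_number_def)
qed

end
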